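(* For every positive integer $k$, the ratio $\frac{\dim_k(G)}{\gamma_k(G)}$ can be arbitrarily large over connected graphs $G$; that is, for every positive integer $k$ and every real number $M$ there exists a connected graph $G$ with $\frac{\dim_k(G)}{\gamma_k(G)}\ge M$.
   Context: All graphs are finite, simple, undirected and connected. $d(x,y)$ is the length of a shortest path between $x$ and $y$ in $G$. For a positive integer $k$, let $d_k(x,y)=\min\{d(x,y),k+1\}$. A set $D\subseteq V(G)$ is a distance-$k$ dominating set of $G$ if for each $u\in V(G)\setminus D$ there is $w\in D$ with $d(u,w)\le k$; the distance-$k$ domination number $\gamma_k(G)$ is the minimum cardinality of a distance-$k$ dominating set. A set $S\subseteq V(G)$ is a distance-$k$ resolving set of $G$ if for any distinct $x,y\in V(G)$ there is $z\in S$ with $d_k(x,z)\ne d_k(y,z)$; the distance-$k$ dimension $\dim_k(G)$ is the minimum cardinality of a distance-$k$ resolving set. *)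

theory Defs
  imports Complex_Main "Graph_Theory.Graph_Theory"
begin

text \<open>
  A finite simple undirected graph is a \<^locale>\<open>pair_graph\<close>: finitely many vertices, and a
  symmetric loop-free set of ordered pairs as arcs. The notions below are stated for an arbitrary
  \<^locale>\<open>pre_digraph\<close> and are only meaningful for finite connected graphs; between two vertices with no
  connecting path, \<open>graph_dist\<close> is unspecified.
\<close>

definition (in pre_digraph) graph_dist :: "'a \<Rightarrow> 'a \<Rightarrow> nat" where
  "graph_dist x y = (LEAST n. \<exists>p. apath x p y \<and> length p = n)"

definition (in pre_digraph) trunc_dist :: "nat \<Rightarrow> 'a \<Rightarrow> 'a \<Rightarrow> nat" where
  "trunc_dist k x y = min (graph_dist x y) (k + 1)"

definition (in pre_digraph) distance_dominating :: "nat \<Rightarrow> 'a set \<Rightarrow> bool" where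
  "distance_dominating k D \<longleftrightarrow>
     D \<subseteq> verts G \<and> (\<forall>u \<in> verts G - D. \<exists>w \<in> D. graph_dist u w \<le> k)"

definition (in pre_digraph) distance_domination_number :: "nat \<Rightarrow> nat" where
  "distance_domination_number k = (LEAST n. \<exists>D. distance_dominating k D \<and> card D = n)"

definition (in pre_digraph) distance_resolving :: "nat \<Rightarrow> 'a set \<Rightarrow> bool" where
  "distance_resolving k S \<longleftrightarrow>
     S \<subseteq> verts G \<and>
     (\<forall>x \<in> verts G. \<forall>y \<in> verts G. x \<noteq> y \<longrightarrow>
        (\<exists>z \<in> S. trunc_dist k x z \<noteq> trunc_dist k y z))"

definition (in pre_digraph) distance_dimension :: "nat \<Rightarrow> nat" where
  "distance_dimension k = (LEAST n. \<exists>S. distance_resolving k S \<and> card S = n)"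

text \<open>The distance agrees with the library's shortest-path cost for unit arc weights.\<close>

lemma (in wf_digraph) graph_dist_eq_mu:
  assumes "x \<rightarrow>\<^sup>* y"
  shows "ereal (real (graph_dist x y)) = \<mu> (\<lambda>_. 1) x y"
proof -
  have cost: "awalk_cost (\<lambda>_. 1) p = real (length p)" for p :: "'b list"
    by (induct p) (auto simp: awalk_cost_def)
  let ?P = "\<lambda>n. \<exists>p. apath x p y \<and> length p = n"
  from assms have "\<exists>p. apath x p y"
    by (auto simp: reachable_apath)
  then have "\<exists>n. ?P n" by blast
  then have "?P (graph_dist x y)"
    unfolding graph_dist_def by (rule LeastI_ex)
  then obtain p where p: "apath x p y" "length p = graph_dist x y" by blast
  have le: "graph_dist x y \<le> length q" if "awalk x q y" for q
  proof -
    have "apath x (awalk_to_apath q) y"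
      using that by (rule apath_awalk_to_apath)
    then have "graph_dist x y \<le> length (awalk_to_apath q)"
      unfolding graph_dist_def by (intro Least_le) blast
    also have "\<dots> \<le> length q"
      using awalk_to_path_no_neg_cyc_cost[OF that, of "\<lambda>_. 1"] by (simp add: cost)
    finally show ?thesis .
  qed
  show ?thesis
  proof (rule antisym)
    show "ereal (real (graph_dist x y)) \<le> \<mu> (\<lambda>_. 1) x y"
      unfolding \<mu>_def by (rule INF_greatest) (auto simp: cost le)
    show "\<mu> (\<lambda>_. 1) x y \<le> ereal (real (graph_dist x y))"
      using min_cost_le_walk_cost[of x p y "\<lambda>_. 1"] p by (simp add: cost apath_def)
  qed
qed

end

theory Submission
  imports Defs
begin

text \<open>
  In the complete graph on \<open>n\<close> vertices all distinct vertices are at distance \<open>1\<close>. Hence one vertex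
  dominates the graph, whereas a vertex outside \<open>S\<close> has distance \<open>1\<close> to every member of \<open>S\<close>, so a
  resolving set misses at most one vertex and the ratio is at least \<open>n - 1\<close>.
\<close>

context wf_digraph
begin

lemma graph_dist_self:
  assumes "x \<in> verts G"
  shows "graph_dist x x = 0"
  unfolding graph_dist_def
  by (rule Least_eq_0) (use assms in \<open>auto simp: apath_Nil_iff\<close>)

text \<open>The arc itself is a path of length 1, and the empty path only joins a vertex to itself.
  A \<open>wf_digraph\<close> may have loops, so adjacency alone does not give
  \<open>x \<noteq> y\<close>.\<close>

lemma graph_dist_adj:
  assumes "x \<rightarrow>\<^bsub>G\<^esub> y" "x \<noteq> y"
  shows "graph_dist x y = 1"
  unfolding graph_dist_def
proof (rule Least_equality)
  from assms(1) obtain e where "e \<in> arcs G" "tail G e = x" "head G e = y"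
    by (auto simp: arcs_ends_def arc_to_ends_def)
  with assms(2) have "apath x [e] y"
    by (auto simp: apath_Cons_iff apath_Nil_iff)
  then show "\<exists>p. apath x p y \<and> length p = 1"
    by (intro exI[of _ "[e]"]) simp
next
  fix m assume "\<exists>p. apath x p y \<and> length p = m"
  with assms(2) show "1 \<le> m"
    by (cases m) (auto simp: apath_Nil_iff)
qed

end

context fin_digraph
begin

text \<open>Any singleton dominates because \<open>k > 0\<close> puts every neighbour within
  distance \<open>k\<close>; the empty set fails because there is a vertex left to dominate.\<close>

lemma domination_number_complete:
  assumes complete: "\<And>x y. x \<in> verts G \<Longrightarrow> y \<in> verts G \<Longrightarrow> x \<noteq> y \<Longrightarrow> x \<rightarrow>\<^bsub>G\<^esub> y"
    and "k > 0" "verts G \<noteq> {}"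
  shows "distance_domination_number k = 1"
  unfolding distance_domination_number_def
proof (rule Least_equality)
  from \<open>verts G \<noteq> {}\<close> obtain v where "v \<in> verts G" by blast
  with \<open>k > 0\<close> have "distance_dominating k {v}"
    by (auto simp: distance_dominating_def graph_dist_adj complete)
  then show "\<exists>D. distance_dominating k D \<and> card D = 1"
    by (intro exI[of _ "{v}"]) simp
next
  fix m assume "\<exists>D. distance_dominating k D \<and> card D = m"
  then obtain D where D: "distance_dominating k D" "card D = m" by blast
  \<comment> \<open>An infinite set would have \<open>card\<close> 0, so the lower bound needs
    finiteness.\<close>
  then have "finite D"
    by (auto simp: distance_dominating_def intro: finite_subset)
  moreover have "D \<noteq> {}"
    using D(1) \<open>verts G \<noteq> {}\<close> by (auto simp: distance_dominating_def)
  ultimately show "1 \<le> m"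
    using D(2) by (auto simp: Suc_le_eq card_gt_0_iff)
qed

lemma dimension_complete_ge:
  assumes complete: "\<And>x y. x \<in> verts G \<Longrightarrow> y \<in> verts G \<Longrightarrow> x \<noteq> y \<Longrightarrow> x \<rightarrow>\<^bsub>G\<^esub> y"
  shows "card (verts G) - 1 \<le> distance_dimension k"
proof -
  \<comment> \<open>Some resolving set must exist for the \<open>LEAST\<close> to be attained. Here
    \<open>z = x\<close> separates \<open>x\<close> from \<open>y\<close>, with truncated distances
    0 and 1.\<close>
  have "distance_resolving k (verts G)"
    unfolding distance_resolving_def trunc_dist_def
    by (force simp: graph_dist_self graph_dist_adj complete)
  then have "\<exists>n S. distance_resolving k S \<and> card S = n" by blast
  from LeastI_ex[OF this] obtain S
    where S: "distance_resolving k S" "card S = distance_dimension k"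
    unfolding distance_dimension_def by blast
  have sub: "S \<subseteq> verts G"
    using S(1) by (simp add: distance_resolving_def)
  have "x = y" if "x \<in> verts G - S" "y \<in> verts G - S" for x y
  proof (rule ccontr)
    assume "x \<noteq> y"
    with that S(1) obtain z where z: "z \<in> S" "trunc_dist k x z \<noteq> trunc_dist k y z"
      unfolding distance_resolving_def by blast
    have "graph_dist x z = 1" "graph_dist y z = 1"
      \<comment> \<open>Both \<open>x\<close> and \<open>y\<close> lie outside \<open>S\<close>,
        hence differ from \<open>z\<close>. Keeping \<open>1\<close> unexpanded lets
        \<open>graph_dist_adj\<close> match.\<close>
      using that z(1) sub by (auto simp del: One_nat_def intro!: graph_dist_adj complete)
    with z(2) show False by (simp add: trunc_dist_def)
  qed
  then have "card (verts G - S) \<le> 1"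
    by (auto simp: card_le_Suc0_iff_eq)
  moreover have "card (verts G - S) = card (verts G) - card S"
    using sub by (intro card_Diff_subset finite_subset[OF sub]) auto
  ultimately show ?thesis using S(2) by linarith
qed

end

theorem proposition2p8:
  fixes k :: nat and M :: real
  assumes "k > 0"
  shows "\<exists>G :: nat pair_pre_digraph. pair_graph G \<and> Digraph_Component.connected (with_proj G) \<and>
           real (pre_digraph.distance_dimension (with_proj G) k) /
           real (pre_digraph.distance_domination_number (with_proj G) k) \<ge> M"
proof -
  \<comment> \<open>Then \<open>n - 1\<close> is at least \<open>M\<close>, and the added 1 keeps
    the graph nonempty when \<open>M \<le> 0\<close>.\<close>
  define n where "n = nat \<lceil>M\<rceil> + 1"
  define G :: "nat pair_pre_digraph" where
    "G = \<lparr> pverts = {..<n}, parcs = {(x, y). x < n \<and> y < n \<and> x \<noteq> y} \<rparr>"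
  have "finite {(x, y). x < n \<and> y < n \<and> x \<noteq> y}"
    by (rule finite_subset[of _ "{..<n} \<times> {..<n}"]) auto
  then interpret pair_graph G
    by unfold_locales (auto simp: G_def symmetric_def arcs_ends_def arc_to_ends_def intro!: symI)
  have complete: "(x, y) \<in> parcs G" if "x \<in> pverts G" "y \<in> pverts G" "x \<noteq> y" for x y
    using that by (simp add: G_def)
  have ne: "pverts G \<noteq> {}"
    by (auto simp: G_def n_def lessThan_empty_iff)
  \<comment> \<open>Connectedness is reachability in the symmetric closure; a single arc of
    \<open>G\<close> already joins any two distinct vertices.\<close>
  have "Digraph_Component.connected (with_proj G)"
  proof (rule connectedI)
    fix u v assume "u \<in> pverts G" "v \<in> pverts G"
    then have "u \<rightarrow>\<^sup>*\<^bsub>with_proj G\<^esub> v"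
      using complete[of u v] by (cases "u = v") auto
    then show "u \<rightarrow>\<^sup>*\<^bsub>mk_symmetric (with_proj G)\<^esub> v"
      by (rule reachable_mk_symmetricI)
  qed (fact ne)
  moreover have "pre_digraph.distance_domination_number (with_proj G) k = 1"
    by (rule domination_number_complete[OF complete \<open>k > 0\<close> ne])
  moreover have "n - 1 \<le> pre_digraph.distance_dimension (with_proj G) k"
    using dimension_complete_ge[OF complete] by (simp add: G_def)
  then have "M \<le> real (pre_digraph.distance_dimension (with_proj G) k)"
    unfolding n_def by linarith
  ultimately show ?thesis
    using pair_graph_axioms by (intro exI[of _ G]) simp
qed

end
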